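(* The resource theory of kinematic T-violation (unital channels under conversion by T-symmetric superchannels) is neither quantity-like nor quality-like. That is: (a) it is not true that for all unital channels $a_1,a_2,b_1,b_2$, the conditions $a_1\otimes a_2\simeq b_1\otimes b_2$ and $b_1\succ a_1$ together imply $a_2\succ b_2$; (b) it is not true that $a\otimes a\simeq a$ for every unital channel $a$.
   Context: A system $A=(\mathcal H_A,\Theta_A)$ is a finite-dimensional complex Hilbert space with a fixed orthonormal computational basis, together with an antiunitary operator $\Theta_A$ (the motion-reversal operator). Here all motion-reversal operators are complex conjugation $\theta$ in the computational basis; composite systems carry the tensor product of the motion-reversal operators (complex conjugation in the product basis). Write $\mathrm{Ad}_O(\rho)=O\rho O^\dagger$. A channel on $A$ is a CPTP map $\mathcal B(\mathcal H_A)\to\mathcal B(\mathcal H_A)$; it is unital if it fixes $\mathbb I$. $\dagger$ on maps denotes the Hilbert–Schmidt adjoint. A deterministic superchannel $f:A\multimap B$ is a linear map from linear maps on $\mathcal B(\mathcal H_A)$ to linear maps on $\mathcal B(\mathcal H_B)$ of the form $f(\mathcal E)=\mathcal F_d\circ(\mathcal E\otimes\mathrm{id}_M)\circ\mathcal F_e$, with $M$ a finite-dimensional memory system and $\mathcal F_e:\mathcal B(\mathcal H_B)\to\mathcal B(\mathcal H_A\otimes\mathcal H_M)$, $\mathcal F_d:\mathcal B(\mathcal H_A\otimes\mathcal H_M)\to\mathcal B(\mathcal H_B)$ CPTP. Its adjoint is the supermap $f^\dagger(\mathcal E)=\mathcal F_e^\dagger\circ(\mathcal E\otimes\mathrm{id}_M)\circ\mathcal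 F_d^\dagger$ (independent of the chosen realization). Its reverse-process simulator is $$f_\Theta(\mathcal E)=\mathrm{Ad}_{\Theta_B^\dagger}\circ f^\dagger\big(\mathrm{Ad}_{\Theta_A}\circ\mathcal E\circ\mathrm{Ad}_{\Theta_A^\dagger}\big)\circ\mathrm{Ad}_{\Theta_B}.$$ A deterministic superchannel $f$ is T-symmetric if $f=f_\Theta$. For unital channels $\mathcal E_1$ on $A$ and $\mathcal E_2$ on $B$, write $\mathcal E_1\succ\mathcal E_2$ if $f(\mathcal E_1)=\mathcal E_2$ for some T-symmetric superchannel $f:A\multimap B$, and $\mathcal E_1\simeq\mathcal E_2$ if both $\mathcal E_1\succ\mathcal E_2$ and $\mathcal E_2\succ\mathcal E_1$. *)

theory Defs
  imports "Jordan_Normal_Form.Schur_Decomposition"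
begin

text \<open>
  The system with Hilbert space \<open>\<complex>\<^sup>n\<close> (\<open>n > 0\<close>) and its computational basis is represented by
  \<open>n\<close>, operators on it by \<open>carrier_mat n n\<close>, and a map from \<open>\<B>(\<complex>\<^sup>n)\<close> to \<open>\<B>(\<complex>\<^sup>m)\<close>
  by a HOL function on matrices of which only the restriction to \<open>carrier_mat n n\<close> matters; \<open>map_eq\<close>
  is therefore the equality of such maps.  The composite of \<open>n\<close> and \<open>m\<close> is \<open>n * m\<close>, with
  product basis vector \<open>(i, k)\<close> at position \<open>i * m + k\<close>.
\<close>

type_synonym op_map = "complex mat \<Rightarrow> complex mat"
type_synonym supermap = "op_map \<Rightarrow> op_map"

definition linear_map :: "nat \<Rightarrow> nat \<Rightarrow> op_map \<Rightarrow> bool" where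
  "linear_map n m E \<longleftrightarrow>
     (\<forall>X \<in> carrier_mat n n. E X \<in> carrier_mat m m) \<and>
     (\<forall>X \<in> carrier_mat n n. \<forall>Y \<in> carrier_mat n n. E (X + Y) = E X + E Y) \<and>
     (\<forall>c. \<forall>X \<in> carrier_mat n n. E (c \<cdot>\<^sub>m X) = c \<cdot>\<^sub>m E X)"

definition map_eq :: "nat \<Rightarrow> op_map \<Rightarrow> op_map \<Rightarrow> bool" where
  "map_eq n E F \<longleftrightarrow> (\<forall>X \<in> carrier_mat n n. E X = F X)"

definition matrix_unit :: "nat \<Rightarrow> nat \<Rightarrow> nat \<Rightarrow> complex mat" where
  "matrix_unit n i j = mat n n (\<lambda>(r, s). if r = i \<and> s = j then 1 else 0)"

definition kron :: "complex mat \<Rightarrow> complex mat \<Rightarrow> complex mat" where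
  "kron A B = mat (dim_row A * dim_row B) (dim_col A * dim_col B)
     (\<lambda>(r, s). A $$ (r div dim_row B, s div dim_col B) * B $$ (r mod dim_row B, s mod dim_col B))"

text \<open>
  The tensor product of linear maps \<open>E : \<B>(\<complex>\<^sup>n) \<rightarrow> \<B>(\<complex>\<^sup>m)\<close> and \<open>F : \<B>(\<complex>\<^sup>p) \<rightarrow> \<B>(\<complex>\<^sup>q)\<close>,
  given by linear extension from products of matrix units; see \<open>tensor_map_kron\<close> below.
\<close>

definition tensor_map :: "nat \<Rightarrow> nat \<Rightarrow> nat \<Rightarrow> nat \<Rightarrow> op_map \<Rightarrow> op_map \<Rightarrow> op_map" where
  "tensor_map n m p q E F X = mat (m * q) (m * q) (\<lambda>rs.
     \<Sum>i<n. \<Sum>j<n. \<Sum>k<p. \<Sum>l<p. X $$ (i * p + k, j * p + l) *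
       kron (E (matrix_unit n i j)) (F (matrix_unit p k l)) $$ rs)"

definition mat_trace :: "complex mat \<Rightarrow> complex" where
  "mat_trace A = (\<Sum>i<dim_row A. A $$ (i, i))"

text \<open>
  The order on \<^typ>\<open>complex\<close> is the one of \<open>Complex_Order\<close>: \<open>0 \<le> z\<close> says that \<open>z\<close> is real and
  nonnegative, which forces \<open>A\<close> to be Hermitian below.
\<close>

definition positive_op :: "nat \<Rightarrow> complex mat \<Rightarrow> bool" where
  "positive_op n A \<longleftrightarrow> A \<in> carrier_mat n n \<and> (\<forall>v \<in> carrier_vec n. 0 \<le> (A *\<^sub>v v) \<bullet>c v)"

definition completely_positive :: "nat \<Rightarrow> nat \<Rightarrow> op_map \<Rightarrow> bool" where
  "completely_positive n m E \<longleftrightarrow>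
     (\<forall>k X. positive_op (n * k) X \<longrightarrow> positive_op (m * k) (tensor_map n m k k E (\<lambda>Y. Y) X))"

definition trace_preserving :: "nat \<Rightarrow> op_map \<Rightarrow> bool" where
  "trace_preserving n E \<longleftrightarrow> (\<forall>X \<in> carrier_mat n n. mat_trace (E X) = mat_trace X)"

definition channel :: "nat \<Rightarrow> nat \<Rightarrow> op_map \<Rightarrow> bool" where
  "channel n m E \<longleftrightarrow> linear_map n m E \<and> completely_positive n m E \<and> trace_preserving n E"

definition unital_channel :: "nat \<Rightarrow> op_map \<Rightarrow> bool" where
  "unital_channel n E \<longleftrightarrow> n > 0 \<and> channel n n E \<and> E (1\<^sub>m n) = 1\<^sub>m n"

definition hs_inner :: "complex mat \<Rightarrow> complex mat \<Rightarrow> complex" where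
  "hs_inner A B = mat_trace (mat_adjoint A * B)"

text \<open>
  The Hilbert--Schmidt adjoint of \<open>E : \<B>(\<complex>\<^sup>n) \<rightarrow> \<B>(\<complex>\<^sup>m)\<close>, given by its entries in the
  orthonormal basis of matrix units; see \<open>hs_adjoint_inner\<close> below.
\<close>

definition hs_adjoint :: "nat \<Rightarrow> nat \<Rightarrow> op_map \<Rightarrow> op_map" where
  "hs_adjoint n m E Y = mat n n (\<lambda>(i, j). hs_inner (E (matrix_unit n i j)) Y)"

text \<open>
  Motion reversal is complex conjugation in the computational basis.  It is its own (antilinear)
  adjoint, so the conjugation of an operator \<open>R\<close> by it sends \<open>v\<close> to \<open>\<theta> (R (\<theta> v))\<close>, and the
  columns of the resulting matrix are the images of the basis vectors.
\<close>

definition motion_reversal :: "complex vec \<Rightarrow> complex vec" where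
  "motion_reversal v = conjugate v"

definition Ad_reversal :: "nat \<Rightarrow> op_map" where
  "Ad_reversal n R =
     mat n n (\<lambda>(i, j). motion_reversal (R *\<^sub>v motion_reversal (unit_vec n j)) $ i)"

definition superchannel_realization ::
    "nat \<Rightarrow> nat \<Rightarrow> nat \<Rightarrow> op_map \<Rightarrow> op_map \<Rightarrow> supermap \<Rightarrow> bool" where
  "superchannel_realization nA nB nM Fe Fd f \<longleftrightarrow>
     nM > 0 \<and> channel nB (nA * nM) Fe \<and> channel (nA * nM) nB Fd \<and>
     (\<forall>E. linear_map nA nA E \<longrightarrow>
        map_eq nB (f E) (Fd \<circ> tensor_map nA nA nM nM E (\<lambda>Y. Y) \<circ> Fe))"

definition deterministic_superchannel :: "nat \<Rightarrow> nat \<Rightarrow> supermap \<Rightarrow> bool" where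
  "deterministic_superchannel nA nB f \<longleftrightarrow>
     (\<exists>nM Fe Fd. superchannel_realization nA nB nM Fe Fd f)"

text \<open>
  The result does not depend, up to \<open>map_eq\<close> and on linear arguments, on which realization of the
  superchannel \<open>f\<close> is selected.
\<close>

definition supermap_adjoint :: "nat \<Rightarrow> nat \<Rightarrow> supermap \<Rightarrow> supermap" where
  "supermap_adjoint nA nB f E =
     (let (nM, Fe, Fd) = (SOME (nM, Fe, Fd). superchannel_realization nA nB nM Fe Fd f)
      in hs_adjoint nB (nA * nM) Fe \<circ> tensor_map nA nA nM nM E (\<lambda>Y. Y) \<circ>
           hs_adjoint (nA * nM) nB Fd)"

definition reverse_simulator :: "nat \<Rightarrow> nat \<Rightarrow> supermap \<Rightarrow> supermap" where
  "reverse_simulator nA nB f E =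
     Ad_reversal nB \<circ> supermap_adjoint nA nB f (Ad_reversal nA \<circ> E \<circ> Ad_reversal nA) \<circ>
       Ad_reversal nB"

definition T_symmetric :: "nat \<Rightarrow> nat \<Rightarrow> supermap \<Rightarrow> bool" where
  "T_symmetric nA nB f \<longleftrightarrow> deterministic_superchannel nA nB f \<and>
     (\<forall>E. linear_map nA nA E \<longrightarrow> map_eq nB (f E) (reverse_simulator nA nB f E))"

definition convertible :: "nat \<Rightarrow> op_map \<Rightarrow> nat \<Rightarrow> op_map \<Rightarrow> bool" where
  "convertible nA E1 nB E2 \<longleftrightarrow> (\<exists>f. T_symmetric nA nB f \<and> map_eq nB (f E1) E2)"

definition interconvertible :: "nat \<Rightarrow> op_map \<Rightarrow> nat \<Rightarrow> op_map \<Rightarrow> bool" where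
  "interconvertible nA E1 nB E2 \<longleftrightarrow> convertible nA E1 nB E2 \<and> convertible nB E2 nA E1"

definition channel_tensor :: "nat \<Rightarrow> nat \<Rightarrow> op_map \<Rightarrow> op_map \<Rightarrow> op_map" where
  "channel_tensor n p E F = tensor_map n n p p E F"


subsection \<open>The formulas above have their defining properties\<close>

lemma linear_map_expand:
  assumes E: "linear_map n m E" and X: "X \<in> carrier_mat n n" and r: "r < m" and s: "s < m"
  shows "E X $$ (r, s) = (\<Sum>i<n. \<Sum>j<n. X $$ (i, j) * E (matrix_unit n i j) $$ (r, s))"
proof -
  have U: "matrix_unit n i j \<in> carrier_mat n n" for i j
    by (simp add: matrix_unit_def)
  have C: "E Y \<in> carrier_mat m m" if "Y \<in> carrier_mat n n" for Y
    using E that by (simp add: linear_map_def)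
  define P where "P S = mat n n (\<lambda>(a, b). if (a, b) \<in> S then X $$ (a, b) else 0)" for S
  have PC: "P S \<in> carrier_mat n n" for S by (simp add: P_def)
  have part: "E (P S) $$ (r, s) = (\<Sum>(i, j)\<in>S. X $$ (i, j) * E (matrix_unit n i j) $$ (r, s))"
    if "finite S" "S \<subseteq> {..<n} \<times> {..<n}" for S
    using that
  proof (induction S rule: finite_induct)
    case empty
    have "P {} = 0 \<cdot>\<^sub>m P {}" by (auto simp: P_def)
    then have "E (P {}) = 0 \<cdot>\<^sub>m E (P {})"
      using E PC by (metis linear_map_def)
    then have "E (P {}) $$ (r, s) = (0 \<cdot>\<^sub>m E (P {})) $$ (r, s)" by simp
    also have "\<dots> = 0" using C[OF PC[of "{}"]] r s by simp
    finally show ?case by simp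
  next
    case (insert x S)
    obtain i j where x: "x = (i, j)" by fastforce
    have "P (insert x S) = P S + X $$ (i, j) \<cdot>\<^sub>m matrix_unit n i j"
      using insert.hyps x by (intro eq_matI) (auto simp: P_def matrix_unit_def)
    then have "E (P (insert x S)) = E (P S) + X $$ (i, j) \<cdot>\<^sub>m E (matrix_unit n i j)"
      using E PC U by (simp add: linear_map_def)
    then have "E (P (insert x S)) $$ (r, s) =
        E (P S) $$ (r, s) + X $$ (i, j) * E (matrix_unit n i j) $$ (r, s)"
      using C[OF PC[of S]] C[OF U[of i j]] r s by simp
    then show ?case using insert x by simp
  qed
  have "P ({..<n} \<times> {..<n}) = X" using X by (auto simp: P_def)
  then show ?thesis using part[of "{..<n} \<times> {..<n}"] by (simp add: sum.cartesian_product)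
qed

lemma tensor_map_kron:
  assumes E: "linear_map n m E" and F: "linear_map p q F"
    and X: "X \<in> carrier_mat n n" and Y: "Y \<in> carrier_mat p p"
  shows "tensor_map n m p q E F (kron X Y) = kron (E X) (F Y)"
proof -
  have EX: "E X \<in> carrier_mat m m" and FY: "F Y \<in> carrier_mat q q"
    using E F X Y by (simp_all add: linear_map_def)
  have EU: "E (matrix_unit n i j) \<in> carrier_mat m m"
    and FU: "F (matrix_unit p i j) \<in> carrier_mat q q" for i j
    using E F by (simp_all add: linear_map_def matrix_unit_def)
  have lt: "i * p + k < n * p" if "i < n" "k < p" for i k
  proof -
    have "i * p + k < Suc i * p" using that by simp
    also have "\<dots> \<le> n * p" using that by (intro mult_right_mono) auto
    finally show ?thesis .
  qed
  have kr: "kron X Y $$ (i * p + k, j * p + l) = X $$ (i, j) * Y $$ (k, l)"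
    if "i < n" "j < n" "k < p" "l < p" for i j k l
    using that X Y by (simp add: kron_def lt)
  show ?thesis
  proof (rule eq_matI)
    fix r s assume "r < dim_row (kron (E X) (F Y))" "s < dim_col (kron (E X) (F Y))"
    then have rs: "r < m * q" "s < m * q" using EX FY by (simp_all add: kron_def)
    have q: "q > 0" using rs by (cases q) auto
    have b: "r div q < m" "s div q < m" "r mod q < q" "s mod q < q"
      using rs q by (simp_all add: less_mult_imp_div_less)
    have "tensor_map n m p q E F (kron X Y) $$ (r, s) =
      (\<Sum>i<n. \<Sum>j<n. \<Sum>k<p. \<Sum>l<p. (X $$ (i, j) * E (matrix_unit n i j) $$ (r div q, s div q)) *
         (Y $$ (k, l) * F (matrix_unit p k l) $$ (r mod q, s mod q)))"
      using rs EU FU by (simp add: tensor_map_def kr) (simp add: kron_def mult_ac carrier_matD[OF EU] carrier_matD[OF FU])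
    also have "\<dots> = E X $$ (r div q, s div q) * F Y $$ (r mod q, s mod q)"
      unfolding linear_map_expand[OF E X b(1,2)] linear_map_expand[OF F Y b(3,4)]
      by (simp only: sum_distrib_right) (simp only: sum_distrib_left)
    also have "\<dots> = kron (E X) (F Y) $$ (r, s)"
      using rs EX FY by (simp add: kron_def)
    finally show "tensor_map n m p q E F (kron X Y) $$ (r, s) = kron (E X) (F Y) $$ (r, s)" .
  qed (use EX FY in \<open>simp_all add: tensor_map_def kron_def\<close>)
qed

lemma hs_inner_entries:
  assumes "A \<in> carrier_mat n n" "B \<in> carrier_mat n n"
  shows "hs_inner A B = (\<Sum>r<n. \<Sum>s<n. cnj (A $$ (r, s)) * B $$ (r, s))"
proof -
  have "hs_inner A B = (\<Sum>s<n. \<Sum>r<n. cnj (A $$ (r, s)) * B $$ (r, s))"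
    using assms
    by (auto simp: hs_inner_def mat_trace_def mat_adjoint_def scalar_prod_def atLeast0LessThan
        mat_of_rows_def intro!: sum.cong)
  then show ?thesis by (subst sum.swap)
qed

lemma sum_swap_pairs:
  fixes g :: "'a \<Rightarrow> 'b \<Rightarrow> 'c \<Rightarrow> 'd \<Rightarrow> complex"
  shows "(\<Sum>i\<in>I. \<Sum>j\<in>J. \<Sum>r\<in>R. \<Sum>s\<in>S. g i j r s) = (\<Sum>r\<in>R. \<Sum>s\<in>S. \<Sum>i\<in>I. \<Sum>j\<in>J. g i j r s)"
  by (simp only: sum.swap[where A = J and B = R] sum.swap[where A = I and B = R]
      sum.swap[where A = J and B = S] sum.swap[where A = I and B = S])

lemma hs_adjoint_inner:
  assumes E: "linear_map n m E" and X: "X \<in> carrier_mat n n" and Y: "Y \<in> carrier_mat m m"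
  shows "hs_inner (hs_adjoint n m E Y) X = hs_inner Y (E X)"
proof -
  have EX: "E X \<in> carrier_mat m m" using E X by (simp add: linear_map_def)
  have EU: "E (matrix_unit n i j) \<in> carrier_mat m m" for i j
    using E by (simp add: linear_map_def matrix_unit_def)
  have "hs_inner (hs_adjoint n m E Y) X =
      (\<Sum>i<n. \<Sum>j<n. cnj (hs_inner (E (matrix_unit n i j)) Y) * X $$ (i, j))"
    using X by (subst hs_inner_entries[of _ n]) (auto simp: hs_adjoint_def)
  also have "\<dots> = (\<Sum>i<n. \<Sum>j<n. \<Sum>r<m. \<Sum>s<m.
      cnj (Y $$ (r, s)) * (X $$ (i, j) * E (matrix_unit n i j) $$ (r, s)))"
    by (simp add: hs_inner_entries[OF EU Y] sum_distrib_left sum_distrib_right mult_ac)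
  also have "\<dots> = (\<Sum>r<m. \<Sum>s<m. \<Sum>i<n. \<Sum>j<n.
      cnj (Y $$ (r, s)) * (X $$ (i, j) * E (matrix_unit n i j) $$ (r, s)))"
    by (rule sum_swap_pairs)
  also have "\<dots> = hs_inner Y (E X)"
    by (simp add: hs_inner_entries[OF Y EX] linear_map_expand[OF E X] sum_distrib_left)
  finally show ?thesis .
qed

lemma Ad_reversal_apply:
  assumes "R \<in> carrier_mat n n" "v \<in> carrier_vec n"
  shows "Ad_reversal n R *\<^sub>v v = motion_reversal (R *\<^sub>v motion_reversal v)"
    and "Ad_reversal n R = map_mat cnj R"
proof -
  have u: "conjugate (unit_vec n j) = (unit_vec n j :: complex vec)" for j
    by (intro eq_vecI) (auto simp: unit_vec_def)
  show *: "Ad_reversal n R = map_mat cnj R"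
    using assms by (auto simp: Ad_reversal_def motion_reversal_def u)
  show "Ad_reversal n R *\<^sub>v v = motion_reversal (R *\<^sub>v motion_reversal v)"
    unfolding * using assms
    by (intro eq_vecI) (auto simp: motion_reversal_def scalar_prod_def)
qed

end

(*
  Time reversal transposes the matrix of a linear map in the basis of matrix units, and a superchannel
  is T-symmetric iff it commutes with this transposition.

  (a) Let s be conjugation by the cyclic shift of three levels.  The permutation
  (u, v) |-> (u, u + v) conjugates shift (x) id into shift (x) shift, and conjugation by it is a
  T-symmetric superchannel, so s converts to s (x) s.  Take a1 = s (x) s, a2 = id on the trivial
  system and b1 = b2 = s: both tensor products are s (x) s, but a2 equals its time reversal and
  s does not, so a2 does not convert to s.

  (b) Let s' be the time reversal of s and a = (2 s + s') / 3.  A conversion f from a to a (x) a also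
  takes the time reversal of a to that of a (x) a, which by linearity fixes f s and f s'; the
  resulting f s is not positive.
*)

theory Submission
  imports Defs
begin

subsection \<open>Linear maps and matrix units\<close>

lemma matrix_unit_carrier [simp]: "matrix_unit n i j \<in> carrier_mat n n"
  by (simp add: matrix_unit_def)

lemma matrix_unit_index:
  "r < n \<Longrightarrow> s < n \<Longrightarrow> matrix_unit n i j $$ (r, s) = (if r = i \<and> s = j then 1 else 0)"
  by (simp add: matrix_unit_def)

lemma sum_matrix_unit:
  assumes "a < n" "b < n"
  shows "(\<Sum>i<n. \<Sum>j<n. g i j * matrix_unit n a b $$ (i, j)) = g a b"
proof -
  have "(\<Sum>j<n. g i j * matrix_unit n a b $$ (i, j)) = (if i = a then g a b else 0)" if "i < n" for i
  proof -
    have "(\<Sum>j<n. g i j * matrix_unit n a b $$ (i, j)) =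
        (\<Sum>j<n. if j = b then (if i = a then g a b else 0) else 0)"
      using that by (intro sum.cong refl) (auto simp: matrix_unit_index)
    then show ?thesis using assms by simp
  qed
  then show ?thesis using assms by simp
qed

lemma linear_map_carrier: "linear_map n m E \<Longrightarrow> X \<in> carrier_mat n n \<Longrightarrow> E X \<in> carrier_mat m m"
  by (simp add: linear_map_def)

text \<open>Matrix units span, so comparing scalar entries of their images suffices; nearly every
  identity of maps below is proved through this rule.\<close>

lemma linear_map_eqI:
  assumes E: "linear_map n m E" and F: "linear_map n m F"
    and eq: "\<And>i j r s. i < n \<Longrightarrow> j < n \<Longrightarrow> r < m \<Longrightarrow> s < m \<Longrightarrow>
      E (matrix_unit n i j) $$ (r, s) = F (matrix_unit n i j) $$ (r, s)"
    and X: "X \<in> carrier_mat n n"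
  shows "E X = F X"
proof (rule eq_matI)
  have C: "E X \<in> carrier_mat m m" "F X \<in> carrier_mat m m"
    using E F X by (auto intro: linear_map_carrier)
  show "dim_row (E X) = dim_row (F X)" "dim_col (E X) = dim_col (F X)" using C by auto
  fix r s assume "r < dim_row (F X)" "s < dim_col (F X)"
  then have rs: "r < m" "s < m" using C by auto
  show "E X $$ (r, s) = F X $$ (r, s)"
    unfolding linear_map_expand[OF E X rs] linear_map_expand[OF F X rs]
    by (intro sum.cong refl) (simp add: eq rs)
qed

lemma linear_map_comp:
  "linear_map n m E \<Longrightarrow> linear_map m k F \<Longrightarrow> linear_map n k (F \<circ> E)"
  by (simp add: linear_map_def)

lemma linear_map_id: "linear_map n n (\<lambda>Y. Y)"
  by (simp add: linear_map_def)

section \<open>Product indices and tensor products of maps\<close>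

lemma index_pair_less:
  fixes i k n p :: nat
  assumes "i < n" "k < p" shows "i * p + k < n * p"
proof -
  have "i * p + k < Suc i * p" using assms by simp
  also have "\<dots> \<le> n * p" using assms by (intro mult_right_mono) auto
  finally show ?thesis .
qed

lemma index_div_less:
  fixes r n p :: nat
  assumes "r < n * p" shows "r div p < n" "r mod p < p"
proof -
  have "p > 0" using assms by (cases p) auto
  then show "r div p < n" "r mod p < p" using assms by (simp_all add: less_mult_imp_div_less)
qed

lemma index_pair_eq_iff:
  fixes i k a p :: nat
  assumes "k < p" shows "i * p + k = a \<longleftrightarrow> i = a div p \<and> k = a mod p"
  using assms by (metis div_mult_mod_eq div_mult_self3 div_less add_cancel_left_right
      mod_mult_self3 mod_less less_nat_zero_code mult.commute)

lemma linear_map_tensor: "linear_map (n * p) (m * q) (tensor_map n m p q E F)"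
  unfolding linear_map_def
proof (intro conjI ballI allI)
  fix X Y :: "complex mat" and c
  assume X: "X \<in> carrier_mat (n * p) (n * p)"
  show "tensor_map n m p q E F X \<in> carrier_mat (m * q) (m * q)"
    by (simp add: tensor_map_def)
  show "tensor_map n m p q E F (c \<cdot>\<^sub>m X) = c \<cdot>\<^sub>m tensor_map n m p q E F X"
    using X by (intro eq_matI) (auto simp: tensor_map_def index_pair_less sum_distrib_left
        mult.assoc intro!: sum.cong)
  assume Y: "Y \<in> carrier_mat (n * p) (n * p)"
  show "tensor_map n m p q E F (X + Y) = tensor_map n m p q E F X + tensor_map n m p q E F Y"
    using X Y by (intro eq_matI) (simp_all add: tensor_map_def index_pair_less
        distrib_right sum.distrib)
qed

lemma matrix_unit_kron:
  assumes "a < n * p" "b < n * p"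
  shows "matrix_unit (n * p) a b =
    kron (matrix_unit n (a div p) (b div p)) (matrix_unit p (a mod p) (b mod p))"
proof (rule eq_matI)
  fix r s
  assume "r < dim_row (kron (matrix_unit n (a div p) (b div p)) (matrix_unit p (a mod p) (b mod p)))"
    "s < dim_col (kron (matrix_unit n (a div p) (b div p)) (matrix_unit p (a mod p) (b mod p)))"
  then have rs: "r < n * p" "s < n * p" by (simp_all add: kron_def matrix_unit_def)
  \<comment> \<open>Quotient and remainder by \<open>p\<close> jointly determine an index, so the
    indicator of \<open>(a, b)\<close> factors.\<close>
  have eq: "x = y \<longleftrightarrow> x div p = y div p \<and> x mod p = y mod p" for x y
    by (metis div_mult_mod_eq)
  show "matrix_unit (n * p) a b $$ (r, s) =
      kron (matrix_unit n (a div p) (b div p)) (matrix_unit p (a mod p) (b mod p)) $$ (r, s)"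
    using rs index_div_less[OF rs(1)] index_div_less[OF rs(2)] eq[of r a] eq[of s b]
    by (auto simp: kron_def matrix_unit_def)
qed (simp_all add: kron_def matrix_unit_def)

text \<open>A matrix unit of the composite is a product of matrix units, so the quadruple sum in
  \<open>tensor_map\<close> collapses to one product of entries.\<close>

lemma tensor_map_unit:
  assumes E: "linear_map n m E" and F: "linear_map p q F"
    and ab: "a < n * p" "b < n * p" and rs: "r < m * q" "s < m * q"
  shows "tensor_map n m p q E F (matrix_unit (n * p) a b) $$ (r, s) =
    E (matrix_unit n (a div p) (b div p)) $$ (r div q, s div q) *
    F (matrix_unit p (a mod p) (b mod p)) $$ (r mod q, s mod q)"
proof -
  have "E (matrix_unit n (a div p) (b div p)) \<in> carrier_mat m m"
    "F (matrix_unit p (a mod p) (b mod p)) \<in> carrier_mat q q"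
    using E F by (auto intro: linear_map_carrier)
  then show ?thesis
    unfolding matrix_unit_kron[OF ab] tensor_map_kron[OF E F matrix_unit_carrier matrix_unit_carrier]
    using rs by (simp add: kron_def)
qed

text \<open>\<open>tensor_map\<close> evaluates its factors only at matrix units, so agreement there
  even gives equality as HOL functions.\<close>

lemma tensor_map_cong:
  assumes "\<And>i j. i < n \<Longrightarrow> j < n \<Longrightarrow> E (matrix_unit n i j) = E' (matrix_unit n i j)"
    and "\<And>k l. k < p \<Longrightarrow> l < p \<Longrightarrow> F (matrix_unit p k l) = F' (matrix_unit p k l)"
  shows "tensor_map n m p q E F = tensor_map n m p q E' F'"
  unfolding tensor_map_def
  by (intro ext cong_mat refl) (auto simp: assms intro!: sum.cong)

lemma tensor_map_one:
  assumes E: "linear_map n m E" and X: "X \<in> carrier_mat n n"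
  shows "tensor_map n m 1 1 E (\<lambda>Y. Y) X = E X"
proof (rule linear_map_eqI[OF _ E _ X])
  show "linear_map n m (tensor_map n m 1 1 E (\<lambda>Y. Y))"
    using linear_map_tensor[of n 1 m 1] by simp
  show "tensor_map n m 1 1 E (\<lambda>Y. Y) (matrix_unit n i j) $$ (r, s) = E (matrix_unit n i j) $$ (r, s)"
    if "i < n" "j < n" "r < m" "s < m" for i j r s
    using that tensor_map_unit[OF E linear_map_id, of i 1 j r s] by (simp add: matrix_unit_def)
qed

subsection \<open>Time reversal of linear maps\<close>

text \<open>
  \<open>Ad\<^sub>\<theta> \<circ> E\<^sup>\<dagger> \<circ> Ad\<^sub>\<theta>\<close> for \<open>E : \<B>(\<complex>\<^sup>n) \<rightarrow> \<B>(\<complex>\<^sup>m)\<close>: both conjugations cancel against the one in the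
  Hilbert--Schmidt inner product, so that the matrix of \<open>E\<close> in the basis of matrix units is
  transposed.
\<close>

definition transpose_map :: "nat \<Rightarrow> nat \<Rightarrow> op_map \<Rightarrow> op_map" where
  "transpose_map n m E Y =
     mat n n (\<lambda>(i, j). \<Sum>r<m. \<Sum>s<m. E (matrix_unit n i j) $$ (r, s) * Y $$ (r, s))"

lemma transpose_map_unit:
  "i < n \<Longrightarrow> j < n \<Longrightarrow> r < m \<Longrightarrow> s < m \<Longrightarrow>
    transpose_map n m E (matrix_unit m r s) $$ (i, j) = E (matrix_unit n i j) $$ (r, s)"
  by (simp add: transpose_map_def sum_matrix_unit)

lemma linear_map_transpose: "linear_map m n (transpose_map n m E)"
  unfolding linear_map_def
proof (intro conjI ballI allI)
  fix X Y :: "complex mat" and c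
  assume X: "X \<in> carrier_mat m m"
  show "transpose_map n m E X \<in> carrier_mat n n"
    by (simp add: transpose_map_def)
  show "transpose_map n m E (c \<cdot>\<^sub>m X) = c \<cdot>\<^sub>m transpose_map n m E X"
    using X by (intro eq_matI) (auto simp: transpose_map_def sum_distrib_left mult_ac
        intro!: sum.cong)
  assume Y: "Y \<in> carrier_mat m m"
  show "transpose_map n m E (X + Y) = transpose_map n m E X + transpose_map n m E Y"
    using X Y by (intro eq_matI) (simp_all add: transpose_map_def distrib_left sum.distrib)
qed

lemma transpose_map_cong:
  assumes "map_eq n E F"
  shows "transpose_map n m E = transpose_map n m F"
  using assms unfolding transpose_map_def map_eq_def
  by (intro ext cong_mat refl) (auto intro!: sum.cong)

lemma transpose_transpose_map:
  assumes E: "linear_map n m E" and X: "X \<in> carrier_mat n n"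
  shows "transpose_map m n (transpose_map n m E) X = E X"
  using linear_map_transpose E _ X by (rule linear_map_eqI) (simp add: transpose_map_unit)

text \<open>The matrix of a composite is a matrix product, and transposition reverses the order of
  the factors.\<close>

lemma transpose_map_comp:
  assumes E: "linear_map n m E" and F: "linear_map m k F" and Y: "Y \<in> carrier_mat k k"
  shows "transpose_map n k (F \<circ> E) Y = transpose_map n m E (transpose_map m k F Y)"
proof -
  have "transpose_map n k (F \<circ> E) Y = (transpose_map n m E \<circ> transpose_map m k F) Y"
  proof (rule linear_map_eqI[OF linear_map_transpose _ _ Y])
    show "linear_map k n (transpose_map n m E \<circ> transpose_map m k F)"
      by (rule linear_map_comp[OF linear_map_transpose linear_map_transpose])
    fix a b i j assume h: "a < k" "b < k" "i < n" "j < n"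
    have "(transpose_map n m E \<circ> transpose_map m k F) (matrix_unit k a b) $$ (i, j) =
        (\<Sum>r<m. \<Sum>s<m. E (matrix_unit n i j) $$ (r, s) * F (matrix_unit m r s) $$ (a, b))"
      unfolding comp_def transpose_map_def[of n m] using h
      by (simp add: transpose_map_unit)
    \<comment> \<open>Expanding \<open>F\<close> at the operator
      \<open>E (matrix_unit n i j)\<close> gives this same matrix product.\<close>
    also have "\<dots> = F (E (matrix_unit n i j)) $$ (a, b)"
      using h by (subst linear_map_expand[OF F]) (auto intro: linear_map_carrier[OF E])
    finally show "transpose_map n k (F \<circ> E) (matrix_unit k a b) $$ (i, j) =
        (transpose_map n m E \<circ> transpose_map m k F) (matrix_unit k a b) $$ (i, j)"
      using h by (simp add: transpose_map_unit)
  qed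
  then show ?thesis by simp
qed

lemma transpose_map_tensor:
  assumes E: "linear_map n m E" and F: "linear_map p q F"
    and Y: "Y \<in> carrier_mat (m * q) (m * q)"
  shows "transpose_map (n * p) (m * q) (tensor_map n m p q E F) Y =
    tensor_map m n q p (transpose_map n m E) (transpose_map p q F) Y"
  using linear_map_transpose linear_map_tensor _ Y
proof (rule linear_map_eqI)
  fix a b i j assume h: "a < m * q" "b < m * q" "i < n * p" "j < n * p"
  show "transpose_map (n * p) (m * q) (tensor_map n m p q E F) (matrix_unit (m * q) a b) $$ (i, j) =
    tensor_map m n q p (transpose_map n m E) (transpose_map p q F) (matrix_unit (m * q) a b) $$ (i, j)"
    using h index_div_less[OF h(1)] index_div_less[OF h(2)] index_div_less[OF h(3)]
      index_div_less[OF h(4)]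
    by (simp add: transpose_map_unit tensor_map_unit[OF E F]
        tensor_map_unit[OF linear_map_transpose linear_map_transpose])
qed

text \<open>The identity has a symmetric matrix, but its transpose acts as the identity only on
  \<open>p\<close> by \<open>p\<close> matrices, whence the detour through matrix units.\<close>

lemma transpose_map_tensor_id:
  assumes E: "linear_map n m E" and Y: "Y \<in> carrier_mat (m * p) (m * p)"
  shows "transpose_map (n * p) (m * p) (tensor_map n m p p E (\<lambda>Y. Y)) Y =
    tensor_map m n p p (transpose_map n m E) (\<lambda>Y. Y) Y"
proof -
  have "transpose_map p p (\<lambda>Y. Y) (matrix_unit p k l) = matrix_unit p k l"
    if "k < p" "l < p" for k l
    using that linear_map_carrier[OF linear_map_transpose matrix_unit_carrier, of p p "\<lambda>Y. Y" k l]
    by (intro eq_matI) (auto simp: transpose_map_unit matrix_unit_index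
        carrier_matD[OF matrix_unit_carrier])
  then have "tensor_map m n p p (transpose_map n m E) (\<lambda>Y. Y) =
      tensor_map m n p p (transpose_map n m E) (transpose_map p p (\<lambda>Y. Y))"
    by (intro tensor_map_cong) simp_all
  then show ?thesis using transpose_map_tensor[OF E linear_map_id Y] by simp
qed

section \<open>Complex conjugation and the Hilbert-Schmidt adjoint\<close>

lemma Ad_reversal_carrier [simp]: "Ad_reversal n X \<in> carrier_mat n n"
  by (simp add: Ad_reversal_def)

lemma Ad_reversal_map_cnj: "X \<in> carrier_mat n n \<Longrightarrow> Ad_reversal n X = map_mat cnj X"
  by (rule Ad_reversal_apply(2)[OF _ zero_carrier_vec])

text \<open>The Hilbert-Schmidt product conjugates the entries of \<open>E\<close>. Conjugating the
  result of the transpose supplies this, and conjugating its argument first leaves \<open>Y\<close>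
  itself unconjugated.\<close>

lemma hs_adjoint_Ad_reversal:
  assumes E: "linear_map n m E" and Y: "Y \<in> carrier_mat m m"
  shows "hs_adjoint n m E Y = Ad_reversal n (transpose_map n m E (Ad_reversal m Y))"
proof -
  have C: "E (matrix_unit n i j) \<in> carrier_mat m m" for i j
    using E by (auto intro: linear_map_carrier)
  have T: "transpose_map n m E (map_mat cnj Y) \<in> carrier_mat n n"
    by (simp add: transpose_map_def)
  show ?thesis
    using Y unfolding Ad_reversal_map_cnj[OF Y] Ad_reversal_map_cnj[OF T]
    by (intro eq_matI) (auto simp: hs_adjoint_def transpose_map_def hs_inner_entries[OF C Y])
qed

lemma Ad_reversal_involution [simp]:
  "X \<in> carrier_mat n n \<Longrightarrow> Ad_reversal n (Ad_reversal n X) = X"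
  by (simp add: Ad_reversal_map_cnj) (auto intro: eq_matI)

text \<open>Matrix units are real, so conjugation on the composite acts factorwise and cancels on
  the memory.\<close>

lemma tensor_map_Ad_reversal:
  assumes E: "linear_map n n E" and X: "X \<in> carrier_mat (n * p) (n * p)"
  shows "tensor_map n n p p (Ad_reversal n \<circ> E \<circ> Ad_reversal n) (\<lambda>Y. Y) X =
    Ad_reversal (n * p) (tensor_map n n p p E (\<lambda>Y. Y) (Ad_reversal (n * p) X))"
proof -
  have U: "map_mat cnj (matrix_unit k i j) = matrix_unit k i j" for k i j
    by (auto intro!: eq_matI simp: matrix_unit_def)
  have C: "E (matrix_unit n i j) \<in> carrier_mat n n" for i j
    using E by (auto intro: linear_map_carrier)
  have T: "tensor_map n n p p E (\<lambda>Y. Y) (map_mat cnj X) \<in> carrier_mat (n * p) (n * p)"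
    by (simp add: tensor_map_def)
  have K: "kron (map_mat cnj (E (matrix_unit n i j))) (matrix_unit p k l) $$ rs =
      cnj (kron (E (matrix_unit n i j)) (matrix_unit p k l) $$ rs)"
    if "fst rs < n * p" "snd rs < n * p" for i j k l rs
    using that index_div_less[of "fst rs" n p] index_div_less[of "snd rs" n p] C[of i j]
    by (cases rs) (auto simp: kron_def matrix_unit_def)
  show ?thesis
    unfolding Ad_reversal_map_cnj[OF X] Ad_reversal_map_cnj[OF T]
    using X
    by (intro eq_matI)
      (auto simp: tensor_map_def Ad_reversal_map_cnj[OF C] Ad_reversal_map_cnj U K index_pair_less
        intro!: sum.cong)
qed

subsection \<open>T-symmetric superchannels\<close>

lemma superchannel_realization_linear:
  assumes "superchannel_realization nA nB nM Fe Fd f"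
  shows "linear_map nB (nA * nM) Fe" "linear_map (nA * nM) nB Fd"
  using assms by (auto simp: superchannel_realization_def channel_def)

lemma superchannel_realization_apply:
  assumes "superchannel_realization nA nB nM Fe Fd f" "linear_map nA nA E" "X \<in> carrier_mat nB nB"
  shows "f E X = Fd (tensor_map nA nA nM nM E (\<lambda>Y. Y) (Fe X))"
  using assms by (auto simp: superchannel_realization_def map_eq_def)

text \<open>Transposition reverses the order of encoder, extended \<open>E\<close> and decoder, and
  fixes the identity on the memory: the circuit runs backwards on the transposed input.\<close>

lemma transpose_map_superchannel:
  assumes R: "superchannel_realization nA nB nM Fe Fd f" and E: "linear_map nA nA E"
    and X: "X \<in> carrier_mat nB nB"
  shows "transpose_map nB nB (f E) X =
    transpose_map nB (nA * nM) Fe (tensor_map nA nA nM nM (transpose_map nA nA E) (\<lambda>Y. Y)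
      (transpose_map (nA * nM) nB Fd X))"
proof -
  note L = superchannel_realization_linear[OF R]
  let ?T = "tensor_map nA nA nM nM E (\<lambda>Y. Y)"
  have "transpose_map nB nB (f E) X = transpose_map nB nB (Fd \<circ> (?T \<circ> Fe)) X"
    using superchannel_realization_apply[OF R E]
    by (subst transpose_map_cong[of _ "f E" "Fd \<circ> (?T \<circ> Fe)"]) (auto simp: map_eq_def)
  also have "\<dots> = transpose_map nB (nA * nM) (?T \<circ> Fe) (transpose_map (nA * nM) nB Fd X)"
    by (intro transpose_map_comp[OF _ L(2) X] linear_map_comp[OF L(1)] linear_map_tensor)
  also have "\<dots> = transpose_map nB (nA * nM) Fe
      (transpose_map (nA * nM) (nA * nM) ?T (transpose_map (nA * nM) nB Fd X))"
    by (intro transpose_map_comp L linear_map_tensor linear_map_carrier[OF linear_map_transpose X])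
  also have "transpose_map (nA * nM) (nA * nM) ?T (transpose_map (nA * nM) nB Fd X) =
      tensor_map nA nA nM nM (transpose_map nA nA E) (\<lambda>Y. Y) (transpose_map (nA * nM) nB Fd X)"
    by (intro transpose_map_tensor_id E linear_map_carrier[OF linear_map_transpose X])
  finally show ?thesis .
qed

text \<open>A supermap is an arbitrary HOL function on HOL functions; the realization is what makes
  it blind to values of a linear argument off the carrier.\<close>

lemma superchannel_cong:
  assumes R: "superchannel_realization nA nB nM Fe Fd f"
    and E: "linear_map nA nA E" and F: "linear_map nA nA F" and "map_eq nA E F"
    and X: "X \<in> carrier_mat nB nB"
  shows "f E X = f F X"
proof -
  have "tensor_map nA nA nM nM E (\<lambda>Y. Y) = tensor_map nA nA nM nM F (\<lambda>Y. Y)"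
    using \<open>map_eq nA E F\<close> by (intro tensor_map_cong) (auto simp: map_eq_def)
  then show ?thesis
    by (simp add: superchannel_realization_apply[OF R E X] superchannel_realization_apply[OF R F X])
qed

text \<open>Here the definition of reversal turns into bare transposition. The right-hand side names
  no realization, so the choice hidden in \<open>supermap_adjoint\<close> is harmless.\<close>

lemma reverse_simulator_transpose:
  assumes f: "deterministic_superchannel nA nB f" and E: "linear_map nA nA E"
    and X: "X \<in> carrier_mat nB nB"
  shows "reverse_simulator nA nB f E X = transpose_map nB nB (f (transpose_map nA nA E)) X"
proof -
  obtain nM Fe Fd where sel:
    "(SOME (nM, Fe, Fd). superchannel_realization nA nB nM Fe Fd f) = (nM, Fe, Fd)"
    by (metis prod_cases3)
  have "\<exists>t. case t of (nM, Fe, Fd) \<Rightarrow> superchannel_realization nA nB nM Fe Fd f"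
    using f by (auto simp: deterministic_superchannel_def)
  from someI_ex[OF this] have R: "superchannel_realization nA nB nM Fe Fd f"
    unfolding sel by simp
  note L = superchannel_realization_linear[OF R]
  let ?k = "nA * nM"
  let ?T = "tensor_map nA nA nM nM E (\<lambda>Y. Y)"
  let ?Y = "transpose_map ?k nB Fd X"
  have Y: "?Y \<in> carrier_mat ?k ?k"
    by (rule linear_map_carrier[OF linear_map_transpose X])
  have TY: "?T ?Y \<in> carrier_mat ?k ?k"
    by (rule linear_map_carrier[OF linear_map_tensor Y])
  have FTY: "transpose_map nB ?k Fe (?T ?Y) \<in> carrier_mat nB nB"
    by (rule linear_map_carrier[OF linear_map_transpose TY])
  have "reverse_simulator nA nB f E X = Ad_reversal nB (hs_adjoint nB ?k Fe
      (tensor_map nA nA nM nM (Ad_reversal nA \<circ> E \<circ> Ad_reversal nA) (\<lambda>Y. Y)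
        (hs_adjoint ?k nB Fd (Ad_reversal nB X))))"
    by (simp add: reverse_simulator_def supermap_adjoint_def sel)
  \<comment> \<open>Once each adjoint is a transpose between two conjugations, all conjugations meet
    in pairs and cancel.\<close>
  also have "\<dots> = transpose_map nB ?k Fe (?T ?Y)"
    using X Y TY FTY by (simp add: hs_adjoint_Ad_reversal[OF L(1)] hs_adjoint_Ad_reversal[OF L(2)]
        tensor_map_Ad_reversal[OF E])
  \<comment> \<open>The double transpose brings the expression into the form of
    \<open>transpose_map_superchannel\<close> at the input
    \<open>transpose_map nA nA E\<close>.\<close>
  also have "?T = tensor_map nA nA nM nM (transpose_map nA nA (transpose_map nA nA E)) (\<lambda>Y. Y)"
    by (intro tensor_map_cong) (simp_all add: transpose_transpose_map[OF E])
  also have "transpose_map nB ?k Fe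
      (tensor_map nA nA nM nM (transpose_map nA nA (transpose_map nA nA E)) (\<lambda>Y. Y) ?Y) =
      transpose_map nB nB (f (transpose_map nA nA E)) X"
    by (rule transpose_map_superchannel[OF R linear_map_transpose X, symmetric])
  finally show ?thesis .
qed

text \<open>Evaluating the equality of \<open>f\<close> with its reverse simulator at the transpose
  of \<open>E\<close> and cancelling the double transpose gives commutation with time
  reversal.\<close>

lemma T_symmetric_transpose:
  assumes f: "T_symmetric nA nB f" and E: "linear_map nA nA E" and X: "X \<in> carrier_mat nB nB"
  shows "f (transpose_map nA nA E) X = transpose_map nB nB (f E) X"
proof -
  have D: "deterministic_superchannel nA nB f" using f by (simp add: T_symmetric_def)
  then obtain nM Fe Fd where R: "superchannel_realization nA nB nM Fe Fd f"
    by (auto simp: deterministic_superchannel_def)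
  have "f (transpose_map nA nA E) X = reverse_simulator nA nB f (transpose_map nA nA E) X"
    using f X by (simp add: T_symmetric_def linear_map_transpose map_eq_def)
  also have "\<dots> = transpose_map nB nB (f (transpose_map nA nA (transpose_map nA nA E))) X"
    by (rule reverse_simulator_transpose[OF D linear_map_transpose X])
  also have "transpose_map nB nB (f (transpose_map nA nA (transpose_map nA nA E))) =
      transpose_map nB nB (f E)"
    by (intro transpose_map_cong)
      (auto simp: map_eq_def transpose_transpose_map[OF E]
        intro!: superchannel_cong[OF R] E linear_map_transpose)
  finally show ?thesis .
qed

text \<open>When the decoder is the transpose of the encoder, running the circuit backwards gives
  the same circuit.\<close>

lemma T_symmetricI:
  assumes nM: "nM > 0" and Fe: "channel nB (nA * nM) Fe" and Fd: "channel (nA * nM) nB Fd"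
    and eq: "map_eq (nA * nM) Fd (transpose_map nB (nA * nM) Fe)"
  shows "T_symmetric nA nB (\<lambda>E. Fd \<circ> tensor_map nA nA nM nM E (\<lambda>Y. Y) \<circ> Fe)" (is "T_symmetric _ _ ?f")
proof -
  have R: "superchannel_realization nA nB nM Fe Fd ?f"
    using nM Fe Fd by (simp add: superchannel_realization_def map_eq_def)
  note L = superchannel_realization_linear[OF R]
  have D: "deterministic_superchannel nA nB ?f"
    using R by (auto simp: deterministic_superchannel_def)
  have eq': "transpose_map (nA * nM) nB Fd X = Fe X" if "X \<in> carrier_mat nB nB" for X
    using transpose_transpose_map[OF L(1) that] transpose_map_cong[OF eq] by simp
  have "?f E X = reverse_simulator nA nB ?f E X"
    if E: "linear_map nA nA E" and X: "X \<in> carrier_mat nB nB" for E X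
  proof -
    have T: "tensor_map nA nA nM nM (transpose_map nA nA (transpose_map nA nA E)) (\<lambda>Y. Y) =
        tensor_map nA nA nM nM E (\<lambda>Y. Y)"
      by (intro tensor_map_cong) (simp_all add: transpose_transpose_map[OF E])
    have "reverse_simulator nA nB ?f E X =
        transpose_map nB (nA * nM) Fe (tensor_map nA nA nM nM E (\<lambda>Y. Y) (Fe X))"
      by (simp only: reverse_simulator_transpose[OF D E X]
          transpose_map_superchannel[OF R linear_map_transpose X] T eq'[OF X])
    also have "\<dots> = Fd (tensor_map nA nA nM nM E (\<lambda>Y. Y) (Fe X))"
      using eq linear_map_carrier[OF linear_map_tensor linear_map_carrier[OF L(1) X]]
      by (simp add: map_eq_def)
    finally show ?thesis by simp
  qed
  then show ?thesis using D by (simp add: T_symmetric_def map_eq_def)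
qed

subsection \<open>Permutation channels\<close>

text \<open>Conjugation by a permutation matrix in pull-back form: level \<open>\<sigma> r\<close>
  is sent to level \<open>r\<close>, so composites pull back in reverse order.\<close>

definition perm_map :: "nat \<Rightarrow> (nat \<Rightarrow> nat) \<Rightarrow> op_map" where
  "perm_map n \<sigma> X = mat n n (\<lambda>(r, s). X $$ (\<sigma> r, \<sigma> s))"

text \<open>The inverse is an explicit argument because it names the time reversal of the
  permutation channel.\<close>

definition inverse_perms :: "nat \<Rightarrow> (nat \<Rightarrow> nat) \<Rightarrow> (nat \<Rightarrow> nat) \<Rightarrow> bool" where
  "inverse_perms n \<sigma> \<tau> \<longleftrightarrow> (\<forall>r<n. \<sigma> r < n \<and> \<tau> r < n \<and> \<tau> (\<sigma> r) = r \<and> \<sigma> (\<tau> r) = r)"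

definition prod_perm :: "nat \<Rightarrow> (nat \<Rightarrow> nat) \<Rightarrow> (nat \<Rightarrow> nat) \<Rightarrow> nat \<Rightarrow> nat" where
  "prod_perm p \<sigma> \<tau> r = \<sigma> (r div p) * p + \<tau> (r mod p)"

lemma prod_perm_1: "prod_perm (Suc 0) \<sigma> (\<lambda>r. r) = \<sigma>"
  by (simp add: prod_perm_def fun_eq_iff)

lemma inverse_perms_sym: "inverse_perms n \<sigma> \<tau> \<Longrightarrow> inverse_perms n \<tau> \<sigma>"
  by (auto simp: inverse_perms_def)

lemma inverse_perms_id: "inverse_perms n (\<lambda>r. r) (\<lambda>r. r)"
  by (auto simp: inverse_perms_def)

lemma inverse_perms_prod:
  assumes "inverse_perms n \<sigma> \<sigma>'" "inverse_perms p \<tau> \<tau>'"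
  shows "inverse_perms (n * p) (prod_perm p \<sigma> \<tau>) (prod_perm p \<sigma>' \<tau>')"
  unfolding inverse_perms_def
proof (intro allI impI)
  fix r assume r: "r < n * p"
  note b = index_div_less[OF r]
  have "\<sigma> (r div p) < n" "\<sigma>' (r div p) < n" "\<tau> (r mod p) < p" "\<tau>' (r mod p) < p"
    "\<sigma>' (\<sigma> (r div p)) = r div p" "\<sigma> (\<sigma>' (r div p)) = r div p"
    "\<tau>' (\<tau> (r mod p)) = r mod p" "\<tau> (\<tau>' (r mod p)) = r mod p"
    using assms b by (auto simp: inverse_perms_def)
  then show "prod_perm p \<sigma> \<tau> r < n * p \<and> prod_perm p \<sigma>' \<tau>' r < n * p \<and>
      prod_perm p \<sigma>' \<tau>' (prod_perm p \<sigma> \<tau> r) = r \<and> prod_perm p \<sigma> \<tau> (prod_perm p \<sigma>' \<tau>' r) = r"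
    by (auto simp: prod_perm_def index_pair_less)
qed

lemma linear_map_perm:
  assumes "inverse_perms n \<sigma> \<tau>" shows "linear_map n n (perm_map n \<sigma>)"
  using assms unfolding linear_map_def inverse_perms_def
  by (auto simp: perm_map_def intro!: eq_matI)

lemma perm_map_unit:
  assumes "inverse_perms n \<sigma> \<tau>" "r < n" "s < n"
  shows "perm_map n \<sigma> (matrix_unit n i j) $$ (r, s) = (if \<sigma> r = i \<and> \<sigma> s = j then 1 else 0)"
  using assms by (auto simp: perm_map_def inverse_perms_def matrix_unit_index)

text \<open>The channel permutes the matrix units, and the transpose of a permutation matrix is its
  inverse.\<close>

lemma transpose_map_perm:
  assumes "inverse_perms n \<sigma> \<tau>" "X \<in> carrier_mat n n"
  shows "transpose_map n n (perm_map n \<sigma>) X = perm_map n \<tau> X"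
  using linear_map_transpose linear_map_perm[OF inverse_perms_sym[OF assms(1)]] _ assms(2)
  by (rule linear_map_eqI)
    (use assms(1) in \<open>auto simp: transpose_map_unit perm_map_unit[OF assms(1)]
      perm_map_unit[OF inverse_perms_sym[OF assms(1)]] inverse_perms_def\<close>)

lemma tensor_map_perm:
  assumes \<sigma>: "inverse_perms n \<sigma> \<sigma>'" and \<tau>: "inverse_perms p \<tau> \<tau>'"
    and X: "X \<in> carrier_mat (n * p) (n * p)"
  shows "tensor_map n n p p (perm_map n \<sigma>) (perm_map p \<tau>) X = perm_map (n * p) (prod_perm p \<sigma> \<tau>) X"
  using linear_map_tensor linear_map_perm[OF inverse_perms_prod[OF \<sigma> \<tau>]] _ X
proof (rule linear_map_eqI)
  fix a b r s assume h: "a < n * p" "b < n * p" "r < n * p" "s < n * p"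
  have "\<tau> (r mod p) < p" "\<tau> (s mod p) < p"
    using \<tau> index_div_less[OF h(3)] index_div_less[OF h(4)] by (auto simp: inverse_perms_def)
  then show "tensor_map n n p p (perm_map n \<sigma>) (perm_map p \<tau>) (matrix_unit (n * p) a b) $$ (r, s) =
      perm_map (n * p) (prod_perm p \<sigma> \<tau>) (matrix_unit (n * p) a b) $$ (r, s)"
    using h index_div_less[OF h(3)] index_div_less[OF h(4)]
    by (auto simp: tensor_map_unit[OF linear_map_perm[OF \<sigma>] linear_map_perm[OF \<tau>]]
        perm_map_unit[OF \<sigma>] perm_map_unit[OF \<tau>] perm_map_unit[OF inverse_perms_prod[OF \<sigma> \<tau>]]
        prod_perm_def index_pair_eq_iff)
qed

lemma tensor_map_perm_id:
  assumes \<sigma>: "inverse_perms n \<sigma> \<sigma>'" and X: "X \<in> carrier_mat (n * p) (n * p)"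
  shows "tensor_map n n p p (perm_map n \<sigma>) (\<lambda>Y. Y) X = perm_map (n * p) (prod_perm p \<sigma> (\<lambda>r. r)) X"
proof -
  have "perm_map p (\<lambda>r. r) (matrix_unit p k l) = matrix_unit p k l" for k l
    by (auto simp: perm_map_def matrix_unit_def)
  then have "tensor_map n n p p (perm_map n \<sigma>) (\<lambda>Y. Y) =
      tensor_map n n p p (perm_map n \<sigma>) (perm_map p (\<lambda>r. r))"
    by (intro tensor_map_cong) simp_all
  then show ?thesis using tensor_map_perm[OF \<sigma> inverse_perms_id X] by simp
qed

section \<open>Permutations as unital channels\<close>

lemma quadratic_form_entries:
  fixes X :: "complex mat"
  assumes "X \<in> carrier_mat n n" "v \<in> carrier_vec n"
  shows "(X *\<^sub>v v) \<bullet>c v = (\<Sum>r<n. \<Sum>s<n. X $$ (r, s) * (v $ s * cnj (v $ r)))"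
  using assms by (auto simp: scalar_prod_def atLeast0LessThan sum_distrib_right mult.assoc
      intro!: sum.cong)

text \<open>The quadratic form of the permuted operator at \<open>v\<close> is that of
  \<open>X\<close> at the permuted vector \<open>?w\<close>.\<close>

lemma positive_op_perm:
  assumes \<sigma>: "inverse_perms n \<sigma> \<tau>" and X: "positive_op n X"
  shows "positive_op n (perm_map n \<sigma> X)"
  unfolding positive_op_def
proof (intro conjI ballI)
  show "perm_map n \<sigma> X \<in> carrier_mat n n" by (simp add: perm_map_def)
  fix v :: "complex vec" assume v: "v \<in> carrier_vec n"
  have XC: "X \<in> carrier_mat n n" using X by (simp add: positive_op_def)
  have reindex: "(\<Sum>r<n. g (\<sigma> r)) = (\<Sum>r<n. g r)" for g :: "nat \<Rightarrow> complex"
    by (rule sum.reindex_bij_witness[of _ \<tau> \<sigma>]) (use \<sigma> in \<open>auto simp: inverse_perms_def\<close>)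
  have \<sigma>': "\<sigma> r < n" "\<tau> (\<sigma> r) = r" if "r < n" for r using \<sigma> that by (auto simp: inverse_perms_def)
  let ?w = "vec n (\<lambda>r. v $ \<tau> r)"
  have "(perm_map n \<sigma> X *\<^sub>v v) \<bullet>c v =
      (\<Sum>r<n. \<Sum>s<n. X $$ (\<sigma> r, \<sigma> s) * (v $ \<tau> (\<sigma> s) * cnj (v $ \<tau> (\<sigma> r))))"
    using v by (subst quadratic_form_entries[of _ n]) (auto simp: perm_map_def \<sigma>')
  also have "\<dots> = (\<Sum>r<n. \<Sum>s<n. X $$ (\<sigma> r, s) * (v $ \<tau> s * cnj (v $ \<tau> (\<sigma> r))))"
    by (subst reindex[of "\<lambda>s. X $$ (_, s) * (v $ \<tau> s * _)"]) simp
  also have "\<dots> = (\<Sum>r<n. \<Sum>s<n. X $$ (r, s) * (v $ \<tau> s * cnj (v $ \<tau> r)))"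
    by (rule reindex)
  also have "\<dots> = (X *\<^sub>v ?w) \<bullet>c ?w"
    using XC by (subst quadratic_form_entries[of _ n]) auto
  finally show "0 \<le> (perm_map n \<sigma> X *\<^sub>v v) \<bullet>c v"
    using X by (simp add: positive_op_def)
qed

lemma channel_perm:
  assumes \<sigma>: "inverse_perms n \<sigma> \<tau>"
  shows "channel n n (perm_map n \<sigma>)"
  unfolding channel_def
proof (intro conjI)
  show "linear_map n n (perm_map n \<sigma>)" by (rule linear_map_perm[OF \<sigma>])
  show "completely_positive n n (perm_map n \<sigma>)"
    unfolding completely_positive_def
  proof (intro allI impI)
    fix k X assume X: "positive_op (n * k) X"
    then have "X \<in> carrier_mat (n * k) (n * k)" by (simp add: positive_op_def)
    then show "positive_op (n * k) (tensor_map n n k k (perm_map n \<sigma>) (\<lambda>Y. Y) X)"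
      using positive_op_perm[OF inverse_perms_prod[OF \<sigma> inverse_perms_id] X]
      by (simp add: tensor_map_perm_id[OF \<sigma>])
  qed
  show "trace_preserving n (perm_map n \<sigma>)"
    unfolding trace_preserving_def
  proof
    fix X :: "complex mat" assume X: "X \<in> carrier_mat n n"
    have "mat_trace (perm_map n \<sigma> X) = (\<Sum>r<n. X $$ (\<sigma> r, \<sigma> r))"
      by (simp add: mat_trace_def perm_map_def)
    also have "\<dots> = (\<Sum>r<n. X $$ (r, r))"
      by (rule sum.reindex_bij_witness[of _ \<tau> \<sigma>]) (use \<sigma> in \<open>auto simp: inverse_perms_def\<close>)
    finally show "mat_trace (perm_map n \<sigma> X) = mat_trace X"
      using X by (simp add: mat_trace_def)
  qed
qed

lemma unital_channel_perm:
  assumes \<sigma>: "inverse_perms n \<sigma> \<tau>" and n: "n > 0"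
  shows "unital_channel n (perm_map n \<sigma>)"
proof -
  have "\<sigma> r < n" "\<sigma> r = \<sigma> s \<longleftrightarrow> r = s" if "r < n" "s < n" for r s
    using \<sigma> that unfolding inverse_perms_def by metis+
  then have "perm_map n \<sigma> (1\<^sub>m n) = 1\<^sub>m n"
    by (intro eq_matI) (simp_all add: perm_map_def)
  then show ?thesis using n channel_perm[OF \<sigma>] by (simp add: unital_channel_def)
qed

text \<open>The whole target serves as system plus memory \<open>p\<close>. The decoder undoes the
  encoding permutation, hence is its transpose, and the conversion is T-symmetric.\<close>

lemma convertible_perm:
  assumes \<omega>: "inverse_perms (n * p) \<omega> \<omega>'" and p: "p > 0"
    and eq: "map_eq (n * p) (perm_map (n * p) \<omega>' \<circ> tensor_map n n p p E (\<lambda>Y. Y) \<circ> perm_map (n * p) \<omega>) F"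
  shows "convertible n E (n * p) F"
proof -
  have "T_symmetric n (n * p)
      (\<lambda>E. perm_map (n * p) \<omega>' \<circ> tensor_map n n p p E (\<lambda>Y. Y) \<circ> perm_map (n * p) \<omega>)"
    using p channel_perm[OF \<omega>] channel_perm[OF inverse_perms_sym[OF \<omega>]]
    by (rule T_symmetricI) (simp add: map_eq_def transpose_map_perm[OF \<omega>])
  then show ?thesis using eq by (auto simp: convertible_def)
qed

text \<open>The witness is the trivial permutation with a memory of dimension one.\<close>

lemma convertible_map_eq:
  assumes E: "linear_map n n E" and eq: "map_eq n E F"
  shows "convertible n E n F"
proof -
  have P: "perm_map n (\<lambda>r. r) X = X" if "X \<in> carrier_mat n n" for X
    using that by (auto simp: perm_map_def)
  have "perm_map n (\<lambda>r. r) (tensor_map n n 1 1 E (\<lambda>Y. Y) (perm_map n (\<lambda>r. r) X)) = F X"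
    if X: "X \<in> carrier_mat n n" for X
    unfolding P[OF X] tensor_map_one[OF E X] P[OF linear_map_carrier[OF E X]]
    using eq X by (simp add: map_eq_def)
  then have "convertible n E (n * 1) F"
    by (intro convertible_perm[OF inverse_perms_id]) (simp_all add: map_eq_def)
  then show ?thesis by simp
qed

subsection \<open>Mixtures\<close>

text \<open>Complex weights suit the linearity statements; sign and normalization enter only for
  positivity and channels.\<close>

definition mix :: "complex \<Rightarrow> complex \<Rightarrow> op_map \<Rightarrow> op_map \<Rightarrow> op_map" where
  "mix c d E F X = c \<cdot>\<^sub>m E X + d \<cdot>\<^sub>m F X"

lemma linear_map_mix:
  assumes E: "linear_map n m E" and F: "linear_map n m F"
  shows "linear_map n m (mix c d E F)"
  unfolding linear_map_def
proof (intro conjI ballI allI)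
  fix X Y :: "complex mat" and e
  assume X: "X \<in> carrier_mat n n"
  have C: "E X \<in> carrier_mat m m" "F X \<in> carrier_mat m m"
    using E F X by (auto intro: linear_map_carrier)
  then show "mix c d E F X \<in> carrier_mat m m" by (simp add: mix_def)
  have "E (e \<cdot>\<^sub>m X) = e \<cdot>\<^sub>m E X" "F (e \<cdot>\<^sub>m X) = e \<cdot>\<^sub>m F X"
    using E F X by (simp_all add: linear_map_def)
  then show "mix c d E F (e \<cdot>\<^sub>m X) = e \<cdot>\<^sub>m mix c d E F X"
    using C by (intro eq_matI) (auto simp: mix_def distrib_left mult_ac)
  assume Y: "Y \<in> carrier_mat n n"
  have D: "E Y \<in> carrier_mat m m" "F Y \<in> carrier_mat m m"
    using E F Y by (auto intro: linear_map_carrier)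
  have "E (X + Y) = E X + E Y" "F (X + Y) = F X + F Y"
    using E F X Y by (simp_all add: linear_map_def)
  then show "mix c d E F (X + Y) = mix c d E F X + mix c d E F Y"
    using C D by (intro eq_matI) (auto simp: mix_def distrib_left)
qed

lemma tensor_map_mix:
  assumes E: "linear_map n m E" and F: "linear_map n m F" and G: "linear_map p q G"
    and X: "X \<in> carrier_mat (n * p) (n * p)"
  shows "tensor_map n m p q (mix c d E F) G X =
    c \<cdot>\<^sub>m tensor_map n m p q E G X + d \<cdot>\<^sub>m tensor_map n m p q F G X"
proof -
  have "tensor_map n m p q (mix c d E F) G X =
      mix c d (tensor_map n m p q E G) (tensor_map n m p q F G) X"
    using linear_map_tensor linear_map_mix[OF linear_map_tensor linear_map_tensor] _ X
  proof (rule linear_map_eqI)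
    fix a b r s assume h: "a < n * p" "b < n * p" "r < m * q" "s < m * q"
    have C: "tensor_map n m p q H G Y \<in> carrier_mat (m * q) (m * q)" for H Y
      by (simp add: tensor_map_def)
    have D: "E (matrix_unit n i j) \<in> carrier_mat m m" "F (matrix_unit n i j) \<in> carrier_mat m m" for i j
      using E F by (auto intro: linear_map_carrier)
    have M: "mix c d E F (matrix_unit n i j) $$ (k, l) =
        c * E (matrix_unit n i j) $$ (k, l) + d * F (matrix_unit n i j) $$ (k, l)"
      if "k < m" "l < m" for i j k l
      using that D[of i j] by (simp add: mix_def)
    have "mix c d (tensor_map n m p q E G) (tensor_map n m p q F G) Y $$ (r, s) =
        c * tensor_map n m p q E G Y $$ (r, s) + d * tensor_map n m p q F G Y $$ (r, s)" for Y
      using C[of E Y] C[of F Y] h by (simp add: mix_def)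
    then show "tensor_map n m p q (mix c d E F) G (matrix_unit (n * p) a b) $$ (r, s) =
        mix c d (tensor_map n m p q E G) (tensor_map n m p q F G) (matrix_unit (n * p) a b) $$ (r, s)"
      using h index_div_less[OF h(3)] index_div_less[OF h(4)]
      by (simp add: tensor_map_unit[OF E G] tensor_map_unit[OF F G] M
          tensor_map_unit[OF linear_map_mix[OF E F] G] algebra_simps)
  qed
  then show ?thesis by (simp add: mix_def)
qed

lemma positive_op_mix:
  assumes X: "positive_op n X" and Y: "positive_op n Y" and "0 \<le> c" "0 \<le> d"
  shows "positive_op n (c \<cdot>\<^sub>m X + d \<cdot>\<^sub>m Y)"
  unfolding positive_op_def
proof (intro conjI ballI)
  have C: "X \<in> carrier_mat n n" "Y \<in> carrier_mat n n"
    using X Y by (simp_all add: positive_op_def)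
  then show "c \<cdot>\<^sub>m X + d \<cdot>\<^sub>m Y \<in> carrier_mat n n" by simp
  fix v :: "complex vec" assume v: "v \<in> carrier_vec n"
  have "((c \<cdot>\<^sub>m X + d \<cdot>\<^sub>m Y) *\<^sub>v v) \<bullet>c v = c * ((X *\<^sub>v v) \<bullet>c v) + d * ((Y *\<^sub>v v) \<bullet>c v)"
    using C v by (simp add: quadratic_form_entries[of _ n] distrib_right sum.distrib
        sum_distrib_left mult.assoc)
  then show "0 \<le> ((c \<cdot>\<^sub>m X + d \<cdot>\<^sub>m Y) *\<^sub>v v) \<bullet>c v"
    using X Y v assms(3,4) by (simp add: positive_op_def)
qed

lemma unital_channel_mix:
  assumes E: "unital_channel n E" and F: "unital_channel n F"
    and cd: "0 \<le> c" "0 \<le> d" "c + d = 1"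
  shows "unital_channel n (mix c d E F)"
proof -
  have L: "linear_map n n E" "linear_map n n F"
    using E F by (simp_all add: unital_channel_def channel_def)
  have "completely_positive n n (mix c d E F)"
    unfolding completely_positive_def
  proof (intro allI impI)
    fix k X assume X: "positive_op (n * k) X"
    then have "X \<in> carrier_mat (n * k) (n * k)" by (simp add: positive_op_def)
    then show "positive_op (n * k) (tensor_map n n k k (mix c d E F) (\<lambda>Y. Y) X)"
      using E F X cd by (simp add: tensor_map_mix[OF L linear_map_id] unital_channel_def
          channel_def completely_positive_def positive_op_mix)
  qed
  moreover have "trace_preserving n (mix c d E F)"
    unfolding trace_preserving_def
  proof
    fix X :: "complex mat" assume X: "X \<in> carrier_mat n n"
    have C: "E X \<in> carrier_mat n n" "F X \<in> carrier_mat n n"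
      using L X by (auto intro: linear_map_carrier)
    have "mat_trace (mix c d E F X) = c * mat_trace (E X) + d * mat_trace (F X)"
      using C by (simp add: mat_trace_def mix_def sum.distrib sum_distrib_left)
    also have "\<dots> = (c + d) * mat_trace X"
      using E F X by (simp add: unital_channel_def channel_def trace_preserving_def ring_distribs)
    finally show "mat_trace (mix c d E F X) = mat_trace X" using cd by simp
  qed
  moreover have "mix c d E F (1\<^sub>m n) = 1\<^sub>m n"
    using E F cd(3) by (auto simp: mix_def unital_channel_def intro!: eq_matI)
  ultimately show ?thesis
    using E linear_map_mix[OF L] by (simp add: unital_channel_def channel_def)
qed

lemma transpose_map_mix:
  assumes E: "linear_map n m E" and F: "linear_map n m F" and X: "X \<in> carrier_mat m m"
  shows "transpose_map n m (mix c d E F) X = mix c d (transpose_map n m E) (transpose_map n m F) X"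
  using linear_map_transpose linear_map_mix[OF linear_map_transpose linear_map_transpose] _ X
proof (rule linear_map_eqI)
  fix a b i j assume h: "a < m" "b < m" "i < n" "j < n"
  have "E (matrix_unit n i j) \<in> carrier_mat m m" "F (matrix_unit n i j) \<in> carrier_mat m m"
    using E F by (auto intro: linear_map_carrier)
  moreover have "transpose_map n m H Y \<in> carrier_mat n n" for H Y
    by (simp add: transpose_map_def)
  then have "dim_row (transpose_map n m H Y) = n" "dim_col (transpose_map n m H Y) = n" for H Y
    by (metis carrier_matD)+
  ultimately show "transpose_map n m (mix c d E F) (matrix_unit m a b) $$ (i, j) =
      mix c d (transpose_map n m E) (transpose_map n m F) (matrix_unit m a b) $$ (i, j)"
    using h by (simp add: transpose_map_unit mix_def)
qed

text \<open>Linearity in the input is read off a realization: extension by the memory and decoding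
  are both linear.\<close>

lemma superchannel_mix:
  assumes R: "superchannel_realization nA nB nM Fe Fd f"
    and E: "linear_map nA nA E" and F: "linear_map nA nA F" and X: "X \<in> carrier_mat nB nB"
  shows "f (mix c d E F) X = c \<cdot>\<^sub>m f E X + d \<cdot>\<^sub>m f F X"
proof -
  note L = superchannel_realization_linear[OF R]
  have FX: "Fe X \<in> carrier_mat (nA * nM) (nA * nM)" by (rule linear_map_carrier[OF L(1) X])
  have "tensor_map nA nA nM nM H (\<lambda>Y. Y) (Fe X) \<in> carrier_mat (nA * nM) (nA * nM)" for H
    by (rule linear_map_carrier[OF linear_map_tensor FX])
  then have "Fd (c \<cdot>\<^sub>m tensor_map nA nA nM nM E (\<lambda>Y. Y) (Fe X) +
      d \<cdot>\<^sub>m tensor_map nA nA nM nM F (\<lambda>Y. Y) (Fe X)) =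
      c \<cdot>\<^sub>m Fd (tensor_map nA nA nM nM E (\<lambda>Y. Y) (Fe X)) +
      d \<cdot>\<^sub>m Fd (tensor_map nA nA nM nM F (\<lambda>Y. Y) (Fe X))"
    using L(2) by (simp add: linear_map_def)
  then show ?thesis
    by (simp only: superchannel_realization_apply[OF R E X] superchannel_realization_apply[OF R F X]
        superchannel_realization_apply[OF R linear_map_mix[OF E F] X]
        tensor_map_mix[OF E F linear_map_id FX])
qed

section \<open>Positivity of superchannel outputs\<close>

lemma completely_positive_imp_positive:
  assumes E: "linear_map n m E" "completely_positive n m E" and X: "positive_op n X"
  shows "positive_op m (E X)"
proof -
  have "positive_op (m * 1) (tensor_map n m 1 1 E (\<lambda>Y. Y) X)"
    using E(2) X unfolding completely_positive_def by (metis mult_1_right)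
  then show ?thesis
    using X tensor_map_one[OF E(1), of X] by (simp add: positive_op_def)
qed

text \<open>Encoder and decoder preserve positivity; complete positivity of \<open>E\<close>, with
  the memory as ancilla, covers the middle.\<close>

lemma superchannel_positive:
  assumes R: "superchannel_realization nA nB nM Fe Fd f"
    and E: "channel nA nA E" and X: "positive_op nB X"
  shows "positive_op nB (f E X)"
proof -
  have "positive_op (nA * nM) (Fe X)"
    using R X by (auto simp: superchannel_realization_def channel_def intro: completely_positive_imp_positive)
  then have "positive_op (nA * nM) (tensor_map nA nA nM nM E (\<lambda>Y. Y) (Fe X))"
    using E by (simp add: channel_def completely_positive_def)
  then have "positive_op nB (Fd (tensor_map nA nA nM nM E (\<lambda>Y. Y) (Fe X)))"
    using R by (auto simp: superchannel_realization_def channel_def intro: completely_positive_imp_positive)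
  then show ?thesis
    using E X by (simp add: superchannel_realization_apply[OF R] channel_def positive_op_def)
qed

lemma positive_op_diag:
  assumes X: "positive_op n X" and i: "i < n"
  shows "0 \<le> X $$ (i, i)"
proof -
  have C: "X \<in> carrier_mat n n" using X by (simp add: positive_op_def)
  have "0 \<le> (X *\<^sub>v unit_vec n i) \<bullet>c unit_vec n i"
    using X by (simp add: positive_op_def)
  also have "conjugate (unit_vec n i) = (unit_vec n i :: complex vec)"
    by (intro eq_vecI) (auto simp: unit_vec_def)
  also have "(X *\<^sub>v unit_vec n i) \<bullet> unit_vec n i = X $$ (i, i)"
    using C i by simp
  finally show ?thesis .
qed

lemma positive_op_unit:
  assumes i: "i < n"
  shows "positive_op n (matrix_unit n i i)"
  unfolding positive_op_def
proof (intro conjI ballI)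
  fix v :: "complex vec" assume v: "v \<in> carrier_vec n"
  have "(matrix_unit n i i *\<^sub>v v) \<bullet>c v =
      (\<Sum>r<n. \<Sum>s<n. (v $ s * cnj (v $ r)) * matrix_unit n i i $$ (r, s))"
    using v by (simp add: quadratic_form_entries[of _ n] mult.commute)
  also have "\<dots> = v $ i * cnj (v $ i)" using i by (simp add: sum_matrix_unit)
  finally show "0 \<le> (matrix_unit n i i *\<^sub>v v) \<bullet>c v"
    by (simp add: complex_mult_cnj less_eq_complex_def)
qed simp

subsection \<open>The cyclic shift on three levels\<close>

definition shift :: "nat \<Rightarrow> nat" where "shift r = (r + 1) mod 3"
text \<open>Adding 2 subtracts 1 modulo 3 and avoids truncated subtraction.\<close>

definition unshift :: "nat \<Rightarrow> nat" where "unshift r = (r + 2) mod 3"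

text \<open>Expanding bounded quantifiers reduces identities of explicit permutations to arithmetic
  on numerals.\<close>

lemma all_less_3: "(\<forall>r<3. P r) \<longleftrightarrow> P 0 \<and> P 1 \<and> P (2 :: nat)"
proof -
  have "r < 3 \<longleftrightarrow> r = 0 \<or> r = 1 \<or> r = 2" for r :: nat by linarith
  then show ?thesis by auto
qed

lemma inverse_perms_shift: "inverse_perms 3 shift unshift"
  unfolding inverse_perms_def all_less_3 by (simp add: shift_def unshift_def)

text \<open>
  The relabelling \<open>(u, v) \<mapsto> (u, u + v)\<close> modulo 3, on positions \<open>3 * u + v\<close>.
\<close>

definition shear :: "nat \<Rightarrow> nat" where "shear r = (r div 3) * 3 + (r mod 3 + r div 3) mod 3"
definition unshear :: "nat \<Rightarrow> nat" where "unshear r = (r div 3) * 3 + (r mod 3 + 2 * (r div 3)) mod 3"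

lemma all_less_9:
  "(\<forall>r<9. P r) \<longleftrightarrow> P 0 \<and> P 1 \<and> P 2 \<and> P 3 \<and> P 4 \<and> P 5 \<and> P 6 \<and> P 7 \<and> P (8 :: nat)"
proof -
  have "r < 9 \<longleftrightarrow> r = 0 \<or> r = 1 \<or> r = 2 \<or> r = 3 \<or> r = 4 \<or> r = 5 \<or> r = 6 \<or> r = 7 \<or> r = 8"
    for r :: nat by linarith
  then show ?thesis by (simp add: all_conj_distrib imp_disjL)
qed

lemma inverse_perms_shear: "inverse_perms 9 shear unshear"
  unfolding inverse_perms_def all_less_9 by (simp add: shear_def unshear_def)

text \<open>On pairs modulo 3: (u, v) goes to (u, v - u), then (u + 1, v - u), then (u + 1, v +
  1).\<close>

lemma shear_shift: "\<forall>r<9. shear (prod_perm 3 shift (\<lambda>r. r) (unshear r)) = prod_perm 3 shift shift r"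
  unfolding all_less_9 by (simp add: shear_def unshear_def prod_perm_def shift_def)

lemma convertible_shift:
  "convertible 3 (perm_map 3 shift) 9 (perm_map 9 (prod_perm 3 shift shift))"
proof -
  have "convertible 3 (perm_map 3 shift) (3 * 3) (perm_map (3 * 3) (prod_perm 3 shift shift))"
  proof (rule convertible_perm)
    show "inverse_perms (3 * 3) shear unshear" using inverse_perms_shear by simp
    \<comment> \<open>Pull-backs compose in reverse order, so the index is first unsheared, then
      shifted, then sheared, as in \<open>shear_shift\<close>.\<close>
    have "perm_map (3 * 3) unshear (perm_map (3 * 3) (prod_perm 3 shift (\<lambda>r. r)) (perm_map (3 * 3) shear X)) =
        perm_map (3 * 3) (prod_perm 3 shift shift) X" for X
    proof -
      have "unshear r < 9" "prod_perm 3 shift (\<lambda>r. r) (unshear r) < 9" if "r < 9" for r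
        using that inverse_perms_shear inverse_perms_prod[OF inverse_perms_shift inverse_perms_id[of 3]]
        by (auto simp: inverse_perms_def)
      then show ?thesis by (auto simp: perm_map_def shear_shift intro!: eq_matI)
    qed
    moreover have "perm_map (3 * 3) shear X \<in> carrier_mat (3 * 3) (3 * 3)" for X
      by (simp add: perm_map_def)
    ultimately show "map_eq (3 * 3) (perm_map (3 * 3) unshear \<circ>
        tensor_map 3 3 3 3 (perm_map 3 shift) (\<lambda>Y. Y) \<circ> perm_map (3 * 3) shear)
        (perm_map (3 * 3) (prod_perm 3 shift shift))"
      unfolding map_eq_def comp_def
      by (intro ballI) (simp only: tensor_map_perm_id[OF inverse_perms_shift])
  qed simp
  then show ?thesis by simp
qed

text \<open>The trivial identity is its own transpose, a property that T-symmetric superchannels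
  pass on to the output; the shift lacks it.\<close>

lemma not_convertible_trivial_shift:
  "\<not> convertible 1 (perm_map 1 (\<lambda>r. r)) 3 (perm_map 3 shift)"
proof
  let ?id = "perm_map 1 (\<lambda>r. r)"
  let ?X = "matrix_unit 3 0 0"
  note id = linear_map_perm[OF inverse_perms_id]
  assume "convertible 1 ?id 3 (perm_map 3 shift)"
  then obtain f where f: "T_symmetric 1 3 f" and eq: "map_eq 3 (f ?id) (perm_map 3 shift)"
    by (auto simp: convertible_def)
  obtain nM Fe Fd where R: "superchannel_realization 1 3 nM Fe Fd f"
    using f by (auto simp: T_symmetric_def deterministic_superchannel_def)
  have "f ?id ?X = f (transpose_map 1 1 ?id) ?X"
    by (rule superchannel_cong[OF R id linear_map_transpose])
      (simp_all add: map_eq_def transpose_map_perm[OF inverse_perms_id])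
  also have "\<dots> = transpose_map 3 3 (f ?id) ?X"
    by (rule T_symmetric_transpose[OF f id]) simp
  also have "\<dots> = perm_map 3 unshift ?X"
    unfolding transpose_map_cong[OF eq] by (simp add: transpose_map_perm[OF inverse_perms_shift])
  \<comment> \<open>The left entry is 1 because \<open>shift 2 = 0\<close>; the right one is 0
    because \<open>unshift 2 = 1\<close>.\<close>
  finally have "perm_map 3 shift ?X $$ (2, 2) = perm_map 3 unshift ?X $$ (2, 2)"
    using eq by (simp add: map_eq_def)
  then show False
    by (simp add: perm_map_unit[OF inverse_perms_shift] shift_def unshift_def
        perm_map_unit[OF inverse_perms_sym[OF inverse_perms_shift]])
qed

text \<open>A pure shift converts to two copies of itself, so noise is added. Unequal weights keep
  the map distinct from its reversal, with likelihood ratio 2.\<close>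

definition biased_shift :: op_map where
  "biased_shift = mix (2/3) (1/3) (perm_map 3 shift) (perm_map 3 unshift)"

lemmas linear_map_shifts =
  linear_map_perm[OF inverse_perms_shift] linear_map_perm[OF inverse_perms_sym[OF inverse_perms_shift]]

lemma linear_map_biased_shift: "linear_map 3 3 biased_shift"
  unfolding biased_shift_def by (intro linear_map_mix linear_map_shifts)

lemma transpose_map_biased_shift:
  "X \<in> carrier_mat 3 3 \<Longrightarrow>
    transpose_map 3 3 biased_shift X = mix (2/3) (1/3) (perm_map 3 unshift) (perm_map 3 shift) X"
  by (simp add: biased_shift_def transpose_map_mix linear_map_shifts mix_def
      transpose_map_perm[OF inverse_perms_shift]
      transpose_map_perm[OF inverse_perms_sym[OF inverse_perms_shift]])

lemma unital_channel_biased_shift: "unital_channel 3 biased_shift"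
  unfolding biased_shift_def
  by (intro unital_channel_mix unital_channel_perm[OF inverse_perms_shift]
      unital_channel_perm[OF inverse_perms_sym[OF inverse_perms_shift]])
    (simp_all add: less_eq_complex_def)

text \<open>These are the transition probabilities from level 0 to level 1 and back. In pull-back
  form \<open>shift\<close> moves 1 to 0, so the larger weight is on the way back.\<close>

lemma biased_shift_entries:
  "biased_shift (matrix_unit 3 0 0) $$ (1, 1) = 1/3"
  "biased_shift (matrix_unit 3 1 1) $$ (0, 0) = 2/3"
proof -
  have "dim_row (perm_map 3 \<sigma> X) = 3" "dim_col (perm_map 3 \<sigma> X) = 3" for \<sigma> X
    by (simp_all add: perm_map_def)
  then show "biased_shift (matrix_unit 3 0 0) $$ (1, 1) = 1/3"
    "biased_shift (matrix_unit 3 1 1) $$ (0, 0) = 2/3"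
    by (simp_all add: biased_shift_def mix_def perm_map_unit[OF inverse_perms_shift]
        perm_map_unit[OF inverse_perms_sym[OF inverse_perms_shift]] shift_def unshift_def)
qed

text \<open>
  A conversion \<open>f\<close> would determine the diagonal entries \<open>p\<close>, \<open>q\<close> of the images under \<open>f\<close> of the shift
  and its inverse through \<open>2p + q = 1/3\<close> and \<open>p + 2q = 4/3\<close>, making \<open>p\<close> negative.  The squared
  likelihood ratio of two copies is what one copy cannot produce.
\<close>

lemma not_convertible_biased_shift:
  "\<not> convertible 3 biased_shift 9 (channel_tensor 3 3 biased_shift biased_shift)"
proof
  let ?a = biased_shift
  let ?aa = "channel_tensor 3 3 ?a ?a"
  let ?X = "matrix_unit 9 0 0"
  assume "convertible 3 ?a 9 ?aa"
  then obtain f where f: "T_symmetric 3 9 f" and eq: "map_eq 9 (f ?a) ?aa"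
    by (auto simp: convertible_def)
  obtain nM Fe Fd where R: "superchannel_realization 3 9 nM Fe Fd f"
    using f by (auto simp: T_symmetric_def deterministic_superchannel_def)
  define P Q where "P = f (perm_map 3 shift) ?X" and "Q = f (perm_map 3 unshift) ?X"
  have P: "positive_op 9 P" and Q: "positive_op 9 Q"
    unfolding P_def Q_def
    by (intro superchannel_positive[OF R] positive_op_unit channel_perm[OF inverse_perms_shift]
        channel_perm[OF inverse_perms_sym[OF inverse_perms_shift]]; simp)+
  \<comment> \<open>Position 4 is the pair (1, 1) and \<open>?X\<close> projects onto (0, 0), so
    both copies make the same transition.\<close>
  define p q where "p = P $$ (4, 4)" and "q = Q $$ (4, 4)"
  have pos: "0 \<le> p" "0 \<le> q"
    unfolding p_def q_def using P Q by (auto intro: positive_op_diag)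
  have C: "dim_row P = 9" "dim_col P = 9" "dim_row Q = 9" "dim_col Q = 9"
    using P Q by (auto simp: positive_op_def)
  have aa: "?aa (matrix_unit 9 i j) $$ (r, s) = ?a (matrix_unit 3 (i div 3) (j div 3)) $$ (r div 3, s div 3) *
      ?a (matrix_unit 3 (i mod 3) (j mod 3)) $$ (r mod 3, s mod 3)"
    if "i < 9" "j < 9" "r < 9" "s < 9" for i j r s
    using that tensor_map_unit[OF linear_map_biased_shift linear_map_biased_shift, of i j r s]
    by (simp add: channel_tensor_def)
  \<comment> \<open>Both copies move from 0 to 1, with probability 1/3 each.\<close>
  have 1: "2/3 * p + 1/3 * q = 1/9"
  proof -
    have "?aa ?X = f ?a ?X" using eq by (simp add: map_eq_def)
    also have "\<dots> = (2/3) \<cdot>\<^sub>m P + (1/3) \<cdot>\<^sub>m Q"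
      unfolding biased_shift_def P_def Q_def
      by (rule superchannel_mix[OF R linear_map_shifts]) simp
    finally have "?aa ?X $$ (4, 4) = 2/3 * p + 1/3 * q"
      using C by (simp add: p_def q_def)
    then show ?thesis by (simp add: aa biased_shift_entries[unfolded One_nat_def])
  qed
  \<comment> \<open>Transposing exchanges source and target, giving 2/3 squared, while on the input
    side it swaps the weights of \<open>P\<close> and \<open>Q\<close>.\<close>
  have 2: "2/3 * q + 1/3 * p = 4/9"
  proof -
    have "transpose_map 9 9 ?aa ?X = transpose_map 9 9 (f ?a) ?X"
      by (simp only: transpose_map_cong[OF eq])
    also have "\<dots> = f (transpose_map 3 3 ?a) ?X"
      by (rule T_symmetric_transpose[OF f linear_map_biased_shift, symmetric]) simp
    also have "\<dots> = f (mix (2/3) (1/3) (perm_map 3 unshift) (perm_map 3 shift)) ?X"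
      by (rule superchannel_cong[OF R linear_map_transpose])
        (auto simp: map_eq_def transpose_map_biased_shift intro!: linear_map_mix linear_map_shifts)
    also have "\<dots> = (2/3) \<cdot>\<^sub>m Q + (1/3) \<cdot>\<^sub>m P"
      unfolding P_def Q_def
      by (rule superchannel_mix[OF R linear_map_shifts(2,1)]) simp
    finally have "transpose_map 9 9 ?aa ?X $$ (4, 4) = 2/3 * q + 1/3 * p"
      using C by (simp add: p_def q_def)
    then show ?thesis by (simp add: transpose_map_unit aa biased_shift_entries[unfolded One_nat_def])
  qed
  \<comment> \<open>Twice the first equation minus the second gives real part -2/9 for
    \<open>p\<close>.\<close>
  have "Re (2/3 * p + 1/3 * q) = 1/9" "Re (2/3 * q + 1/3 * p) = 4/9"
    unfolding 1 2 by simp_all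
  then show False using pos by (simp add: less_eq_complex_def)
qed

section \<open>The two counterexamples\<close>

theorem mainTheorem4:
  shows "\<not> (\<forall>m1 m2 n1 n2 a1 a2 b1 b2.
            unital_channel m1 a1 \<and> unital_channel m2 a2 \<and>
            unital_channel n1 b1 \<and> unital_channel n2 b2 \<longrightarrow>
            interconvertible (m1 * m2) (channel_tensor m1 m2 a1 a2)
                             (n1 * n2) (channel_tensor n1 n2 b1 b2) \<and>
            convertible n1 b1 m1 a1 \<longrightarrow>
            convertible m2 a2 n2 b2)
       \<and> \<not> (\<forall>n a. unital_channel n a \<longrightarrow>
              interconvertible (n * n) (channel_tensor n n a a) n a)"
proof (intro conjI notI)
  let ?s = "perm_map 3 shift"
  let ?ss = "perm_map 9 (prod_perm 3 shift shift)"
  let ?id = "perm_map 1 (\<lambda>r. r)"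
  assume quantity: "\<forall>m1 m2 n1 n2 a1 a2 b1 b2.
      unital_channel m1 a1 \<and> unital_channel m2 a2 \<and> unital_channel n1 b1 \<and> unital_channel n2 b2 \<longrightarrow>
      interconvertible (m1 * m2) (channel_tensor m1 m2 a1 a2) (n1 * n2) (channel_tensor n1 n2 b1 b2) \<and>
      convertible n1 b1 m1 a1 \<longrightarrow> convertible m2 a2 n2 b2"
  have ss: "inverse_perms 9 (prod_perm 3 shift shift) (prod_perm 3 unshift unshift)"
    using inverse_perms_prod[OF inverse_perms_shift inverse_perms_shift] by simp
  have U: "unital_channel 9 ?ss" "unital_channel 1 ?id" "unital_channel 3 ?s"
    by (simp_all add: unital_channel_perm[OF ss] unital_channel_perm[OF inverse_perms_id]
        unital_channel_perm[OF inverse_perms_shift])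
  \<comment> \<open>Both tensor products are the same permutation channel on nine levels, once split
    as 9 times 1 and once as 3 times 3.\<close>
  have "channel_tensor 9 1 ?ss ?id X = channel_tensor 3 3 ?s ?s X"
    if "X \<in> carrier_mat 9 9" for X
    using that tensor_map_perm[OF ss inverse_perms_id, of X 1]
      tensor_map_perm[OF inverse_perms_shift inverse_perms_shift, of X]
    by (simp add: channel_tensor_def prod_perm_1)
  then have eq: "map_eq 9 (channel_tensor 9 1 ?ss ?id) (channel_tensor 3 3 ?s ?s)"
    "map_eq 9 (channel_tensor 3 3 ?s ?s) (channel_tensor 9 1 ?ss ?id)"
    by (auto simp: map_eq_def)
  have L: "linear_map 9 9 (channel_tensor 9 1 ?ss ?id)" "linear_map 9 9 (channel_tensor 3 3 ?s ?s)"
    unfolding channel_tensor_def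
    using linear_map_tensor[of 9 1 9 1] linear_map_tensor[of 3 3 3 3] by simp_all
  have "interconvertible (9 * 1) (channel_tensor 9 1 ?ss ?id) (3 * 3) (channel_tensor 3 3 ?s ?s)"
    using convertible_map_eq[OF L(1) eq(1)] convertible_map_eq[OF L(2) eq(2)]
    by (simp add: interconvertible_def)
  \<comment> \<open>The premise that \<open>b1\<close> converts to \<open>a1\<close> is
    \<open>convertible_shift\<close>; the conclusion would extract a shift from the trivial
    system.\<close>
  then have "convertible 1 ?id 3 ?s"
    using U convertible_shift by (intro quantity[rule_format, of 9 ?ss 1 ?id 3 ?s 3 ?s]) simp_all
  then show False using not_convertible_trivial_shift by simp
next
  assume quality: "\<forall>n a. unital_channel n a \<longrightarrow>
      interconvertible (n * n) (channel_tensor n n a a) n a"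
  \<comment> \<open>Only the direction from one copy to two is refuted.\<close>
  show False
    using quality[rule_format, OF unital_channel_biased_shift] not_convertible_biased_shift
    by (simp add: interconvertible_def)
qed

end
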